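(* The functions $I^4(\tau)$ and $J^4(\tau)$ are modular functions on $\Gamma_1(10)$, and the functions $I(4\tau)$ and $J(4\tau)$ are modular functions on $\Gamma_1(40)$.
   Context: $\tau\in\mathbb{H}$, $q=e^{2\pi i\tau}$, $q^r=e^{2\pi i r\tau}$ for rational $r$, $(a;q)_\infty=\prod_{n\ge0}(1-aq^n)$. Define $I(\tau)=q^{3/4}\dfrac{(q;q^{10})_\infty(q^9;q^{10})_\infty}{(q^4;q^{10})_\infty(q^6;q^{10})_\infty}$ and $J(\tau)=q^{1/4}\dfrac{(q^2;q^{10})_\infty(q^8;q^{10})_\infty}{(q^3;q^{10})_\infty(q^7;q^{10})_\infty}$. $\Gamma_1(N)$ is the group of $\begin{bmatrix} a&b\\ c&d\end{bmatrix}\in\mathrm{SL}_2(\mathbb{Z})$ with $a\equiv d\equiv1$, $c\equiv0\pmod N$. A modular function on $\Gamma$ is a function meromorphic on $\mathbb{H}$, invariant under $\Gamma$, and meromorphic at all cusps. *)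

theory Defs
  imports "HOL-Complex_Analysis.Complex_Analysis" "HOL-Number_Theory.Cong"
begin

definition UHP :: "complex set" where
  "UHP = {z. Im z > 0}"

definition qpow :: "real \<Rightarrow> complex \<Rightarrow> complex" where
  "qpow r \<tau> = exp (2 * of_real pi * \<i> * of_real r * \<tau>)"

definition qpoch_inf :: "complex \<Rightarrow> complex \<Rightarrow> complex" where
  "qpoch_inf a q = (\<Prod>n. (1 - a * q ^ n))"

definition Ifun :: "complex \<Rightarrow> complex" where
  "Ifun \<tau> = (let q = qpow 1 \<tau> in
     qpow (3/4) \<tau> * (qpoch_inf q (q^10) * qpoch_inf (q^9) (q^10))
       / (qpoch_inf (q^4) (q^10) * qpoch_inf (q^6) (q^10)))"

definition Jfun :: "complex \<Rightarrow> complex" where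
  "Jfun \<tau> = (let q = qpow 1 \<tau> in
     qpow (1/4) \<tau> * (qpoch_inf (q^2) (q^10) * qpoch_inf (q^8) (q^10))
       / (qpoch_inf (q^3) (q^10) * qpoch_inf (q^7) (q^10)))"

text \<open>Matrices [a b; c d] of SL_2(Z) represented as tuples (a,b,c,d).\<close>
definition SL2Z :: "(int \<times> int \<times> int \<times> int) set" where
  "SL2Z = {(a,b,c,d). a * d - b * c = 1}"

definition Gamma1 :: "int \<Rightarrow> (int \<times> int \<times> int \<times> int) set" where
  "Gamma1 N = {(a,b,c,d) \<in> SL2Z. [a = 1] (mod N) \<and> [d = 1] (mod N) \<and> [c = 0] (mod N)}"

fun moebius :: "int \<times> int \<times> int \<times> int \<Rightarrow> complex \<Rightarrow> complex" where
  "moebius (a,b,c,d) \<tau> = (of_int a * \<tau> + of_int b) / (of_int c * \<tau> + of_int d)"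

definition meromorphic_at_infinity :: "(complex \<Rightarrow> complex) \<Rightarrow> bool" where
  "meromorphic_at_infinity g \<longleftrightarrow>
     (\<exists>N::nat. N > 0 \<and> (\<exists>F. (\<forall>\<tau>\<in>UHP. g \<tau> = F (qpow (1 / real N) \<tau>)) \<and> F meromorphic_on {0}))"

definition modular_function :: "(int \<times> int \<times> int \<times> int) set \<Rightarrow> (complex \<Rightarrow> complex) \<Rightarrow> bool" where
  "modular_function \<Gamma> f \<longleftrightarrow>
     f meromorphic_on UHP \<and>
     (\<forall>\<gamma>\<in>\<Gamma>. \<forall>\<tau>\<in>UHP. f (moebius \<gamma> \<tau>) = f \<tau>) \<and>
     (\<forall>\<gamma>\<in>SL2Z. meromorphic_at_infinity (\<lambda>\<tau>. f (moebius \<gamma> \<tau>)))"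

end

theory Submission
  imports Defs "HOL-Library.Periodic_Fun"
begin

text \<open>
  Write \<open>ee z = exp (2 \<pi> i z)\<close> and \<open>K\<^bsub>r,s\<^esub>(\<tau>) = ee (r (r \<tau> + s) / 2) \<theta>(r \<tau> + s, \<tau>)\<close>, where
  \<open>\<theta>(z, \<tau>)\<close> is the product \<open>ee (-z/2) (ee z; q) (q / ee z; q)\<close>. Up to a scalar, \<open>\<theta>\<close> is the only entire
  function of \<open>z\<close> vanishing at 0 with its quasi-periods (Liouville), which yields its behaviour
  under \<open>SL\<^sub>2(\<int>)\<close> with an unspecified factor independent of \<open>z\<close>. That factor cancels in quotients, so
  \<open>(K\<^bsub>v\<^esub> / K\<^bsub>w\<^esub>)(\<gamma> \<tau>) = (K\<^bsub>v \<gamma>\<^esub> / K\<^bsub>w \<gamma>\<^esub>)(\<tau>)\<close>.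
  Now \<open>I(\<tau>)\<close> and \<open>J(\<tau>)\<close> are such quotients at \<open>10 \<tau>\<close>, with \<open>v, w\<close> equal to \<open>(1/10, 0), (4/10, 0)\<close> and
  \<open>(2/10, 0), (3/10, 0)\<close>. For \<open>\<gamma>\<close> in the congruence subgroup, \<open>v\<close> and \<open>w\<close> move by integer vectors only,
  which costs an explicit root of unity. At a cusp, \<open>diag(M, 1) \<gamma>\<close> is a matrix of \<open>SL\<^sub>2(\<int>)\<close> times an
  upper triangular one, so the quotient becomes one of products in a fractional power of \<open>q\<close>.
\<close>

section \<open>The normalised exponential\<close>

definition ee :: "complex \<Rightarrow> complex" where
  "ee z = exp (2 * of_real pi * \<i> * z)"

lemma ee_add: "ee (x + y) = ee x * ee y"
  by (simp add: ee_def exp_add ring_distribs)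

lemma ee_minus: "ee (- x) = inverse (ee x)"
  by (simp add: ee_def exp_minus)

lemma ee_diff: "ee (x - y) = ee x / ee y"
  using ee_add[of x "-y"] by (simp add: ee_minus field_simps)

lemma ee_nonzero [simp]: "ee x \<noteq> 0"
  by (simp add: ee_def)

lemma ee_0 [simp]: "ee 0 = 1"
  by (simp add: ee_def)

lemma ee_half: "ee (1/2) = -1"
  by (simp add: ee_def)

lemma ee_eq_1_iff: "ee z = 1 \<longleftrightarrow> (\<exists>n::int. z = of_int n)"
proof -
  have "ee z = 1 \<longleftrightarrow> (\<exists>n::int. 2 * of_real pi * \<i> * z = of_int (2 * n) * pi * \<i>)"
    using exp_eq[of "2 * of_real pi * \<i> * z" 0] by (simp add: ee_def)
  also have "\<dots> \<longleftrightarrow> (\<exists>n::int. z = of_int n)"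
    by (intro iff_exI) (auto simp: mult_ac)
  finally show ?thesis .
qed

lemma ee_of_int [simp]: "ee (of_int n) = 1"
  using ee_eq_1_iff by blast

lemma ee_power: "ee z ^ n = ee (of_nat n * z)"
  by (simp add: ee_def exp_of_nat_mult[symmetric] mult_ac)

lemma ee_powi: "ee z powi n = ee (of_int n * z)"
  by (cases n rule: int_cases2)
     (auto simp: power_int_minus ee_power ee_minus)

lemma ee_cong_int:
  assumes "x - y = of_int n"
  shows "ee x = ee y"
proof -
  have "x = y + of_int n" using assms by (simp add: algebra_simps)
  thus ?thesis by (simp add: ee_add)
qed

lemma qpow_conv_ee: "qpow r \<tau> = ee (of_real r * \<tau>)"
  by (simp add: qpow_def ee_def mult_ac)

lemma norm_ee: "norm (ee z) = exp (- 2 * pi * Im z)"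
  by (simp add: ee_def norm_exp_eq_Re)

lemma norm_ee_less_1: "\<tau> \<in> UHP \<Longrightarrow> norm (ee \<tau>) < 1"
  by (simp add: norm_ee UHP_def)

lemma holomorphic_on_ee [holomorphic_intros]:
  "f holomorphic_on A \<Longrightarrow> (\<lambda>x. ee (f x)) holomorphic_on A"
  unfolding ee_def by (intro holomorphic_intros)

lemma has_field_derivative_ee:
  "(ee has_field_derivative 2 * of_real pi * \<i> * ee z) (at z)"
  unfolding ee_def[abs_def] by (auto intro!: derivative_eq_intros)

section \<open>Infinite q-Pochhammer symbols\<close>

lemma convergent_prod_qpoch:
  fixes a q :: complex
  assumes "norm q < 1"
  shows "convergent_prod (\<lambda>n. 1 - a * q ^ n)"
proof -
  have "summable (\<lambda>n. norm (a * q ^ n))"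
    using assms by (auto simp: norm_mult norm_power intro!: summable_mult summable_geometric)
  thus ?thesis
    by (intro abs_convergent_prod_imp_convergent_prod)
       (simp add: abs_convergent_prod_conv_summable)
qed

lemma qpoch_inf_eq_0_iff:
  assumes "norm q < 1"
  shows "qpoch_inf a q = 0 \<longleftrightarrow> (\<exists>n. a * q ^ n = 1)"
proof -
  have "(\<lambda>n. 1 - a * q ^ n) has_prod qpoch_inf a q"
    unfolding qpoch_inf_def using convergent_prod_qpoch[OF assms] by (rule convergent_prod_has_prod)
  \<comment> \<open>A product that converges in the sense of \<open>has_prod\<close> vanishes only
    when one of its factors does.\<close>
  from has_prod_eq_0_iff[OF this] show ?thesis by (simp add: image_iff)
qed

lemma qpoch_inf_rec:
  assumes "norm q < 1"
  shows "qpoch_inf a q = (1 - a) * qpoch_inf (a * q) q"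
proof -
  have "(\<lambda>n. 1 - a * q ^ n) has_prod
          ((\<Prod>k<1. 1 - a * q ^ k) * (\<Prod>k. 1 - a * q ^ (k + 1)))"
    by (rule has_prod_ignore_initial_segment'[OF convergent_prod_qpoch[OF assms]])
  thus ?thesis
    unfolding qpoch_inf_def by (simp add: has_prod_iff mult_ac)
qed

text \<open>The partial products converge locally uniformly by the Weierstrass M-test. Both
  arguments vary with \<open>z\<close> because at a cusp the base is itself a function of the local
  parameter.\<close>

lemma holomorphic_on_qpoch_inf:
  assumes "open A" and f: "f holomorphic_on A" and g: "g holomorphic_on A"
    and less1: "\<And>z. z \<in> A \<Longrightarrow> norm (g z) < 1"
  shows "(\<lambda>z. qpoch_inf (f z) (g z)) holomorphic_on A"
proof (rule holomorphic_uniform_sequence[OF \<open>open A\<close>])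
  show "(\<lambda>z. \<Prod>n<N. 1 - f z * g z ^ n) holomorphic_on A" for N
    by (intro holomorphic_intros f g)
next
  fix x assume "x \<in> A"
  then obtain d where d: "d > 0" "cball x d \<subseteq> A"
    using \<open>open A\<close> open_contains_cball by blast
  have cont: "continuous_on (cball x d) f" "continuous_on (cball x d) g"
    using f g d(2) by (meson holomorphic_on_imp_continuous_on continuous_on_subset)+
  have "compact (f ` cball x d)"
    using cont by (intro compact_continuous_image) auto
  then obtain B where B: "\<And>z. z \<in> cball x d \<Longrightarrow> norm (f z) \<le> B"
    by (metis compact_imp_bounded bounded_iff imageI)
  \<comment> \<open>By compactness the maximum of the norm of \<open>g\<close> on the ball is
    attained, so the ratio \<open>r\<close> of the majorising geometric series is strictly below
    1.\<close>
  obtain y where y: "y \<in> cball x d" "\<And>z. z \<in> cball x d \<Longrightarrow> norm (g z) \<le> norm (g y)"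
    using continuous_attains_sup[OF _ _ continuous_on_norm[OF cont(2)]] d
    by (metis centre_in_cball compact_cball empty_iff less_imp_le)
  define r where "r = norm (g y)"
  have r: "0 \<le> r" "r < 1" using less1[of y] y d by (auto simp: r_def)
  have "uniformly_convergent_on (cball x d) (\<lambda>N z. \<Prod>n<N. 1 - f z * g z ^ n)"
  proof (rule uniformly_convergent_on_prod')
    show "uniformly_convergent_on (cball x d)
            (\<lambda>N z. \<Sum>n<N. norm (1 - f z * g z ^ n - 1))"
    proof (rule Weierstrass_m_test'_ev)
      show "\<forall>\<^sub>F n in sequentially. \<forall>z\<in>cball x d. norm (norm (1 - f z * g z ^ n - 1)) \<le> B * r ^ n"
      proof (intro always_eventually allI ballI)
        fix n z assume z: "z \<in> cball x d"
        have "0 \<le> B" using B[OF z] norm_ge_zero[of "f z"] by linarith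
        hence "norm (f z) * norm (g z) ^ n \<le> B * r ^ n"
          using B[OF z] y(2)[OF z] unfolding r_def by (intro mult_mono power_mono) auto
        thus "norm (norm (1 - f z * g z ^ n - 1)) \<le> B * r ^ n"
          by (simp add: norm_mult norm_power)
      qed
      show "summable (\<lambda>n. B * r ^ n)"
        using r by (intro summable_mult summable_geometric) auto
    qed
  qed (auto intro!: continuous_intros cont)
  then obtain l where l: "uniform_limit (cball x d) (\<lambda>N z. \<Prod>n<N. 1 - f z * g z ^ n) l sequentially"
    by (auto simp: uniformly_convergent_on_def)
  also have "?this \<longleftrightarrow> uniform_limit (cball x d) (\<lambda>N z. \<Prod>n<N. 1 - f z * g z ^ n)
                         (\<lambda>z. qpoch_inf (f z) (g z)) sequentially"
  proof (intro uniform_limit_cong)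
    fix z assume z: "z \<in> cball x d"
    \<comment> \<open>\<open>convergent_prod_LIMSEQ\<close> speaks of products up to and including
      N, hence the shift by one.\<close>
    with l have "(\<lambda>N. \<Prod>n<Suc N. 1 - f z * g z ^ n) \<longlonglongrightarrow> l z"
      by (intro LIMSEQ_Suc[of "\<lambda>N. \<Prod>n<N. 1 - f z * g z ^ n"] tendsto_uniform_limitI)
    moreover have "(\<lambda>N. \<Prod>n<Suc N. 1 - f z * g z ^ n) \<longlonglongrightarrow> qpoch_inf (f z) (g z)"
      unfolding qpoch_inf_def lessThan_Suc_atMost
      by (rule convergent_prod_LIMSEQ[OF convergent_prod_qpoch]) (use less1 z d in auto)
    ultimately show "l z = qpoch_inf (f z) (g z)"
      by (rule LIMSEQ_unique)
  qed auto
  finally show "\<exists>d>0. cball x d \<subseteq> A \<and> uniform_limit (cball x d)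
      (\<lambda>N z. \<Prod>n<N. 1 - f z * g z ^ n) (\<lambda>z. qpoch_inf (f z) (g z)) sequentially"
    using d by blast
qed

section \<open>The theta function as an infinite product\<close>

text \<open>By the Jacobi triple product this is the odd theta function \<open>theta_1\<close>, up
  to a factor that depends on \<open>\<tau>\<close> alone.\<close>

definition theta :: "complex \<Rightarrow> complex \<Rightarrow> complex" where
  "theta z \<tau> = ee (- z / 2) * (qpoch_inf (ee z) (ee \<tau>) * qpoch_inf (ee (\<tau> - z)) (ee \<tau>))"

lemma theta_0 [simp]: "\<tau> \<in> UHP \<Longrightarrow> theta 0 \<tau> = 0"
  using qpoch_inf_rec[OF norm_ee_less_1, of \<tau> 1] by (simp add: theta_def)

text \<open>One factor must vanish. The first product gives points with m at most 0; the second
  starts at \<open>ee (\<tau> - z)\<close> and gives those with m at least 1.\<close>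

lemma theta_eq_0_imp_lattice:
  assumes "\<tau> \<in> UHP" "theta z \<tau> = 0"
  obtains m n :: int where "z = of_int n + of_int m * \<tau>"
proof -
  from assms have "(\<exists>k. ee z * ee \<tau> ^ k = 1) \<or> (\<exists>k. ee (\<tau> - z) * ee \<tau> ^ k = 1)"
    by (simp add: theta_def qpoch_inf_eq_0_iff norm_ee_less_1)
  thus ?thesis
  proof (elim disjE exE)
    fix k assume "ee z * ee \<tau> ^ k = 1"
    hence "ee (z + of_nat k * \<tau>) = 1" by (simp add: ee_add ee_power)
    then obtain n :: int where "z + of_nat k * \<tau> = of_int n" unfolding ee_eq_1_iff by blast
    thus ?thesis by (intro that[of n "- int k"]) (simp add: algebra_simps)
  next
    fix k assume "ee (\<tau> - z) * ee \<tau> ^ k = 1"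
    hence "ee (\<tau> - z + of_nat k * \<tau>) = 1" by (simp add: ee_add ee_power)
    then obtain n :: int where "\<tau> - z + of_nat k * \<tau> = of_int n" unfolding ee_eq_1_iff by blast
    thus ?thesis by (intro that[of "-n" "int k + 1"]) (simp add: algebra_simps)
  qed
qed

lemma holomorphic_on_theta:
  assumes "open A" "f holomorphic_on A" "g holomorphic_on A" "\<And>z. z \<in> A \<Longrightarrow> g z \<in> UHP"
  shows "(\<lambda>z. theta (f z) (g z)) holomorphic_on A"
  unfolding theta_def
  by (intro holomorphic_intros holomorphic_on_qpoch_inf assms(1,2,3)) (use assms(4) norm_ee_less_1 in auto)

lemma theta_plus_1: "theta (z + 1) \<tau> = - theta z \<tau>"
proof -
  have "ee (- (z + 1) / 2) = - ee (- z / 2)"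
    using ee_diff[of "-z/2" "1/2"] by (simp add: ee_half diff_divide_distrib)
  moreover have "ee (z + 1) = ee z" "ee (\<tau> - (z + 1)) = ee (\<tau> - z)"
    by (rule ee_cong_int[of _ _ 1], simp) (rule ee_cong_int[of _ _ "-1"], simp)
  ultimately show ?thesis by (simp add: theta_def)
qed

text \<open>With x = \<open>ee z\<close>, the shift removes the factor 1 - x from the first product
  and adds 1 - 1/x to the second; their ratio is -1/x.\<close>

lemma theta_plus_tau:
  assumes "\<tau> \<in> UHP"
  shows "theta (z + \<tau>) \<tau> = - ee (- z - \<tau> / 2) * theta z \<tau>"
proof -
  note q = norm_ee_less_1[OF assms]
  let ?P = "\<lambda>a. qpoch_inf a (ee \<tau>)"
  have 1: "?P (ee z) = (1 - ee z) * ?P (ee (z + \<tau>))"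
    using qpoch_inf_rec[OF q, of "ee z"] by (simp add: ee_add)
  have 2: "?P (ee (- z)) = (1 - ee (- z)) * ?P (ee (\<tau> - z))"
    using qpoch_inf_rec[OF q, of "ee (- z)"] by (simp add: ee_add ee_diff ee_minus field_simps)
  have 3: "ee (- (z + \<tau>) / 2) * (1 - ee (- z)) = - (ee (- z - \<tau> / 2) * ee (- z / 2) * (1 - ee z))"
  proof -
    have "ee (- z - \<tau> / 2) * ee (- z / 2) = ee (- (z + \<tau>) / 2) * ee (- z)"
      unfolding ee_add[symmetric] by (rule arg_cong[of _ _ ee]) (simp add: field_simps)
    thus ?thesis by (simp add: ee_minus field_simps)
  qed
  have "theta (z + \<tau>) \<tau> = (ee (- (z + \<tau>) / 2) * (1 - ee (- z))) * ?P (ee (z + \<tau>)) * ?P (ee (\<tau> - z))"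
    using 2 by (simp add: theta_def)
  also have "\<dots> = - ee (- z - \<tau> / 2) * theta z \<tau>"
    unfolding 3 by (simp add: theta_def 1)
  finally show ?thesis .
qed

text \<open>The zero at 0 is simple: it comes from the factor 1 - \<open>ee z\<close> alone, and the
  cofactor \<open>P\<close> does not vanish at 0.\<close>

lemma theta_deriv_0:
  assumes "\<tau> \<in> UHP"
  obtains D where "D \<noteq> 0" "((\<lambda>z. theta z \<tau>) has_field_derivative D) (at 0)"
proof -
  note q = norm_ee_less_1[OF assms]
  define P where "P z = ee (- z / 2) * (qpoch_inf (ee (z + \<tau>)) (ee \<tau>) * qpoch_inf (ee (\<tau> - z)) (ee \<tau>))" for z
  have eq: "(\<lambda>z. theta z \<tau>) = (\<lambda>z. (1 - ee z) * P z)"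
    by (rule ext, subst theta_def, subst qpoch_inf_rec[OF q]) (simp add: P_def ee_add)
  have "P holomorphic_on UNIV"
    unfolding P_def by (intro holomorphic_intros holomorphic_on_qpoch_inf q) auto
  then obtain P' where P': "(P has_field_derivative P') (at 0)"
    by (metis UNIV_I holomorphic_derivI open_UNIV)
  have "ee \<tau> * ee \<tau> ^ n \<noteq> 1" for n
  proof
    assume "ee \<tau> * ee \<tau> ^ n = 1"
    hence "norm (ee \<tau>) ^ Suc n = 1" by (metis norm_one norm_power power_Suc)
    thus False using q power_Suc_less_one[of "norm (ee \<tau>)" n] by (simp del: power_Suc)
  qed
  hence "P 0 \<noteq> 0" using q by (simp add: P_def qpoch_inf_eq_0_iff)
  moreover have "((\<lambda>z. theta z \<tau>) has_field_derivative - (2 * of_real pi * \<i>) * P 0) (at 0)"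
    unfolding eq by (auto intro!: derivative_eq_intros P' has_field_derivative_ee)
  ultimately show ?thesis by (intro that[of "- (2 * of_real pi * \<i>) * P 0"]) auto
qed

section \<open>Uniqueness of theta by Liouville's theorem\<close>

lemma periodic_lattice:
  fixes h :: "complex \<Rightarrow> complex"
  assumes "\<And>z. h (z + 1) = h z" "\<And>z. h (z + \<tau>) = h z"
  shows "h (z + (of_int n + of_int m * \<tau>)) = h z"
proof -
  interpret p1: periodic_fun_simple h 1 by standard (rule assms)
  interpret p2: periodic_fun_simple h \<tau> by standard (rule assms)
  show ?thesis
    using p1.plus_of_int[of z n] p2.plus_of_int[of "z + of_int n" m] by (simp add: add_ac)
qed

text \<open>All values are already taken on a compact period parallelogram, so the function is
  bounded and Liouville applies.\<close>

lemma doubly_periodic_entire_is_constant: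
  assumes \<tau>: "\<tau> \<in> UHP" and h: "h holomorphic_on UNIV"
    and per: "\<And>z. h (z + 1) = h z" "\<And>z. h (z + \<tau>) = h z"
  shows "h z = h w"
proof -
  define p where "p = (\<lambda>(x, y). of_real x + of_real y * \<tau>)"
  let ?K = "p ` ({0..1} \<times> {0..1})"
  have "compact ?K"
    unfolding p_def case_prod_unfold
    by (intro compact_continuous_image compact_Times continuous_intros) auto
  hence "compact (h ` ?K)"
    by (rule compact_continuous_image[rotated])
       (meson h holomorphic_on_imp_continuous_on continuous_on_subset subset_UNIV)
  hence "bounded (h ` ?K)" by (rule compact_imp_bounded)
  moreover have "range h \<subseteq> h ` ?K"
  proof safe
    fix z
    \<comment> \<open>Coordinates of \<open>z\<close> in the real basis 1, \<open>\<tau>\<close>;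
      their fractional parts land in the parallelogram.\<close>
    define y where "y = Im z / Im \<tau>"
    define x where "x = Re z - y * Re \<tau>"
    have z: "z = of_real x + of_real y * \<tau>"
      using \<tau> by (auto simp: complex_eq_iff x_def y_def UHP_def)
    have "h z = h (p (frac x, frac y) + (of_int \<lfloor>x\<rfloor> + of_int \<lfloor>y\<rfloor> * \<tau>))"
      by (rule arg_cong[of _ _ h]) (simp add: z p_def frac_def algebra_simps)
    also have "\<dots> = h (p (frac x, frac y))"
      by (rule periodic_lattice[of h \<tau>, OF per])
    finally have "h z = h (p (frac x, frac y))" .
    moreover have "p (frac x, frac y) \<in> ?K"
      by (intro imageI) (simp add: frac_ge_0 less_imp_le[OF frac_lt_1])
    ultimately show "h z \<in> h ` ?K" by simp
  qed
  ultimately have "bounded (range h)" using bounded_subset by blast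
  hence "h constant_on UNIV" using h by (intro Liouville_theorem)
  thus ?thesis by (auto simp: constant_on_def)
qed

text \<open>The quotient of \<open>G\<close> by theta is elliptic; its only possible poles are the lattice points, where
  the simple zeros of theta are cancelled by the zeros of \<open>G\<close>.\<close>
lemma quasiperiodic_imp_multiple_of_theta:
  assumes \<tau>: "\<tau> \<in> UHP" and G: "G holomorphic_on UNIV" and G0: "G 0 = 0"
    and G1: "\<And>z. G (z + 1) = - G z"
    and G\<tau>: "\<And>z. G (z + \<tau>) = - ee (- z - \<tau> / 2) * G z"
  shows "\<exists>C. \<forall>z. G z = C * theta z \<tau>"
proof -
  define T where "T = (\<lambda>z. theta z \<tau>)"
  have T: "T holomorphic_on UNIV"
    unfolding T_def by (intro holomorphic_on_theta holomorphic_intros \<tau>) auto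
  obtain D where D: "D \<noteq> 0" "(T has_field_derivative D) (at 0)"
    unfolding T_def using theta_deriv_0[OF \<tau>] .
  obtain D' where D': "(G has_field_derivative D') (at 0)"
    using G by (metis UNIV_I holomorphic_derivI open_UNIV)
  \<comment> \<open>The value D'/D at the zeros of \<open>T\<close> is the limit of G/T at 0. Using
    it at every zero keeps \<open>h\<close> doubly periodic.\<close>
  define h where "h z = (if T z = 0 then D' / D else G z / T z)" for z
  have T1: "T (z + 1) = - T z" for z
    by (simp add: T_def theta_plus_1)
  have T\<tau>: "T (z + \<tau>) = - ee (- z - \<tau> / 2) * T z" for z
    by (simp add: T_def theta_plus_tau[OF \<tau>])
  have per: "h (z + 1) = h z" "h (z + \<tau>) = h z" for z
    by (simp_all add: h_def T1 T\<tau> G1 G\<tau>)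

  have T0: "T 0 = 0" by (simp add: T_def \<tau>)
  have limT: "((\<lambda>z. T z / z) \<longlongrightarrow> D) (at 0)"
    using D(2) by (simp add: has_field_derivative_iff T0)
  have limG: "((\<lambda>z. G z / z) \<longlongrightarrow> D') (at 0)"
    using D' by (simp add: has_field_derivative_iff G0)
  have ev: "eventually (\<lambda>z. T z \<noteq> 0) (at 0)"
    using tendsto_imp_eventually_ne[OF limT D(1)] by eventually_elim auto
  have lim: "(h \<longlongrightarrow> h 0) (at 0)"
  proof (rule Lim_transform_eventually)
    show "((\<lambda>z. (G z / z) / (T z / z)) \<longlongrightarrow> h 0) (at 0)"
      using tendsto_divide[OF limG limT D(1)] by (simp add: h_def T0)
    show "eventually (\<lambda>z. (G z / z) / (T z / z) = h z) (at 0)"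
      using ev eventually_neq_at_within[of 0] by eventually_elim (auto simp: h_def)
  qed
  have hol_off: "h holomorphic_on {z. T z \<noteq> 0}"
  proof (rule holomorphic_transform)
    show "(\<lambda>z. G z / T z) holomorphic_on {z. T z \<noteq> 0}"
      by (intro holomorphic_intros holomorphic_on_subset[OF G] holomorphic_on_subset[OF T]) auto
  qed (auto simp: h_def)
  have open_off: "open {z. T z \<noteq> 0}"
    using T by (intro open_Collect_neq continuous_on_const holomorphic_on_imp_continuous_on)
  from ev obtain r where r: "r > 0" "\<And>z. z \<noteq> 0 \<Longrightarrow> dist z 0 < r \<Longrightarrow> T z \<noteq> 0"
    unfolding eventually_at by auto
  have hol_ball: "h holomorphic_on ball 0 r"
  \<comment> \<open>\<open>T\<close> has no other zero in the ball and \<open>h\<close> is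
    continuous at 0, so the singularity there is removable.\<close>
  proof (rule no_isolated_singularity'[of "{0}"])
    show "h holomorphic_on ball 0 r - {0}"
      by (rule holomorphic_on_subset[OF hol_off]) (use r in \<open>auto simp: dist_commute\<close>)
  qed (use lim r in \<open>auto intro: tendsto_within_subset\<close>)
  have "h field_differentiable at z" for z
  proof (cases "T z = 0")
    case False
    thus ?thesis
      using hol_off open_off by (auto simp: holomorphic_on_open field_differentiable_def)
  next
    case True
    then obtain m n :: int where z: "z = of_int n + of_int m * \<tau>"
      using theta_eq_0_imp_lattice[OF \<tau>] unfolding T_def by metis
    \<comment> \<open>Translation by the lattice point \<open>c\<close> carries \<open>z\<close> to
      0, where \<open>h\<close> is already known to be differentiable.\<close>
    define c where "c = of_int n + of_int m * \<tau>"
    have "h field_differentiable at (z - c)"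
      using hol_ball r by (intro holomorphic_on_imp_differentiable_at[OF hol_ball]) (auto simp: z c_def)
    hence "(\<lambda>w. h (w - c)) field_differentiable at z"
      using field_differentiable_compose[of "\<lambda>w. w - c" z h]
      by (simp add: o_def field_differentiable_diff)
    moreover have "h (w - c) = h w" for w
      using periodic_lattice[of h \<tau> "w - c" n m, OF per] by (simp add: c_def)
    ultimately show ?thesis by simp
  qed
  hence "h holomorphic_on UNIV" by (simp add: holomorphic_on_def field_differentiable_at_within)
  hence "h z = h 0" for z using doubly_periodic_entire_is_constant[OF \<tau> _ per] by blast
  hence const: "h z = D' / D" for z by (simp add: h_def T0)
  have "G z = D' / D * T z" for z
  proof (cases "T z = 0")
    case False
    thus ?thesis using const[of z] by (simp add: h_def field_simps)
  next
    case True
    then obtain m n :: int where z: "z = of_int n + of_int m * \<tau>"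
      using theta_eq_0_imp_lattice[OF \<tau>] unfolding T_def by metis
    \<comment> \<open>Where \<open>T\<close> vanishes, \<open>h\<close> carries no information about
      \<open>G\<close>. The multipliers of \<open>G\<close> are nonzero, so the indicator of its
      nonvanishing is truly periodic, and the zero at 0 spreads to the whole lattice.\<close>
    define g where "g w = (if G w = 0 then 0 else 1 :: complex)" for w
    have "g (0 + (of_int n + of_int m * \<tau>)) = g 0"
      by (rule periodic_lattice) (simp_all add: g_def G1 G\<tau>)
    hence "G z = 0" by (auto simp: g_def G0 z split: if_splits)
    thus ?thesis using True by simp
  qed
  thus ?thesis unfolding T_def by blast
qed

section \<open>Theta under arbitrary lattice translations\<close>

lemma ee_mult_eqI: "x + y = z \<Longrightarrow> ee x * ee y = ee z"
  by (auto simp: ee_add)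

lemma ee_odd_half: "odd k \<Longrightarrow> ee (of_int k / 2) = -1"
  by (elim oddE) (simp add: add_divide_distrib ee_add ee_half)

lemma theta_plus_of_int: "theta (z + of_int n) \<tau> = ee (of_int n / 2) * theta z \<tau>"
proof -
  \<comment> \<open>Dividing by the expected multiplier leaves a function of period 1 on the
    integers, which covers positive and negative shifts at once.\<close>
  define H where "H k = theta (z + of_int k) \<tau> * ee (- of_int k / 2)" for k :: int
  interpret periodic_fun_simple H 1
  proof
    fix k :: int
    have "ee (- of_int (k + 1) / 2) = ee (- of_int k / 2 - 1 / 2)"
      by (rule arg_cong[of _ _ ee]) (simp add: field_simps)
    also have "\<dots> = - ee (- of_int k / 2)"
      by (simp add: ee_diff ee_half)
    finally have "ee (- of_int (k + 1) / 2) = - ee (- of_int k / 2)" .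
    thus "H (k + 1) = H k"
      using theta_plus_1[of "z + of_int k" \<tau>] by (simp add: H_def add_ac)
  qed
  have "H n = H 0" using plus_of_int[of 0 n] by simp
  thus ?thesis by (simp add: H_def ee_minus field_simps)
qed

lemma theta_plus_int_tau:
  assumes "\<tau> \<in> UHP"
  shows "theta (z + of_int m * \<tau>) \<tau> =
           ee (of_int m / 2 - of_int m * z - of_int m ^ 2 * \<tau> / 2) * theta z \<tau>"
proof -
  \<comment> \<open>\<open>E\<close> sums the one-step exponents 1/2 - (z + i \<open>\<tau>\<close>)
    - \<open>\<tau>\<close>/2 over i < k, where 1/2 encodes the sign -1.\<close>
  define E where "E k = of_int k / 2 - of_int k * z - of_int k ^ 2 * \<tau> / 2" for k :: int
  define H where "H k = theta (z + of_int k * \<tau>) \<tau> * ee (- E k)" for k :: int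
  interpret periodic_fun_simple H 1
  proof
    fix k :: int
    have eq: "z + of_int (k + 1) * \<tau> = (z + of_int k * \<tau>) + \<tau>"
      by (simp add: algebra_simps)
    have "H (k + 1) = theta (z + of_int k * \<tau>) \<tau> *
            ((ee (1/2) * ee (- (z + of_int k * \<tau>) - \<tau> / 2)) * ee (- E (k + 1)))"
      unfolding H_def eq by (subst theta_plus_tau[OF assms]) (simp add: ee_half)
    also have "(ee (1/2) * ee (- (z + of_int k * \<tau>) - \<tau> / 2)) * ee (- E (k + 1)) = ee (- E k)"
      unfolding ee_add[symmetric]
      by (rule arg_cong[of _ _ ee]) (simp add: E_def field_simps power2_eq_square)
    finally show "H (k + 1) = H k" by (simp add: H_def)
  qed
  have "H m = H 0" using plus_of_int[of 0 m] by simp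
  moreover have "E 0 = 0" by (simp add: E_def)
  ultimately have "theta (z + of_int m * \<tau>) \<tau> = ee (E m) * theta z \<tau>"
    by (simp add: H_def ee_minus field_simps)
  thus ?thesis unfolding E_def .
qed

lemma theta_plus_lattice:
  assumes "\<tau> \<in> UHP"
  shows "theta (z + of_int m * \<tau> + of_int n) \<tau> =
           ee (of_int (m + n) / 2 - of_int m * z - of_int m ^ 2 * \<tau> / 2) * theta z \<tau>"
proof -
  have "ee (of_int n / 2) * ee (of_int m / 2 - of_int m * z - of_int m ^ 2 * \<tau> / 2) =
          ee (of_int (m + n) / 2 - of_int m * z - of_int m ^ 2 * \<tau> / 2)"
    by (rule ee_mult_eqI) (simp add: field_simps)
  thus ?thesis
    by (simp add: theta_plus_of_int theta_plus_int_tau[OF assms] flip: mult.assoc)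
qed

section \<open>Modular transformations\<close>

lemma moebius_denom_nonzero:
  assumes "(a, b, c, d) \<in> SL2Z" "\<tau> \<in> UHP"
  shows "of_int c * \<tau> + of_int d \<noteq> 0"
proof
  assume *: "of_int c * \<tau> + of_int d = 0"
  hence "Im (of_int c * \<tau> + of_int d) = 0" by simp
  hence "c = 0" using assms(2) by (simp add: UHP_def)
  with * assms(1) show False by (simp add: SL2Z_def)
qed

lemma moebius_in_UHP:
  assumes "\<gamma> \<in> SL2Z" "\<tau> \<in> UHP"
  shows "moebius \<gamma> \<tau> \<in> UHP"
proof -
  obtain a b c d where \<gamma>: "\<gamma> = (a, b, c, d)" by (cases \<gamma>) auto
  define j where "j = of_int c * \<tau> + of_int d"
  have j: "j \<noteq> 0" using moebius_denom_nonzero assms by (simp add: \<gamma> j_def)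
  have "a * d - b * c = 1" using assms(1) by (simp add: \<gamma> SL2Z_def)
  hence det: "real_of_int a * real_of_int d - real_of_int b * real_of_int c = 1"
    by (metis of_int_1 of_int_diff of_int_mult)
  have "Im (of_int a * \<tau> + of_int b) * Re j - Re (of_int a * \<tau> + of_int b) * Im j =
          Im \<tau> * (real_of_int a * real_of_int d - real_of_int b * real_of_int c)"
    by (simp add: j_def algebra_simps)
  hence "Im (moebius \<gamma> \<tau>) = Im \<tau> / ((Re j)\<^sup>2 + (Im j)\<^sup>2)"
    by (simp add: \<gamma> Im_divide flip: j_def) (simp add: det)
  moreover have "(Re j)\<^sup>2 + (Im j)\<^sup>2 > 0"
    using j by (metis complex_neq_0)
  ultimately show ?thesis using assms(2) by (simp add: UHP_def)
qed

text \<open>Provides a test point at which the factor in the transformation law is seen to be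
  nonzero.\<close>

lemma theta_half_nonzero:
  assumes "\<tau> \<in> UHP"
  shows "theta (1/2) \<tau> \<noteq> 0"
proof
  assume "theta (1/2) \<tau> = 0"
  then obtain m n :: int where *: "1/2 = of_int n + of_int m * \<tau>"
    using theta_eq_0_imp_lattice[OF assms] by metis
  have "Im (1/2) = Im (of_int n + of_int m * \<tau>)" by (subst *) (rule refl)
  hence "m = 0" using assms by (simp add: UHP_def)
  hence "complex_of_int (2 * n) = of_int 1" using * by (simp add: mult.commute)
  hence "2 * n = 1" unfolding of_int_eq_iff .
  thus False by presburger
qed

text \<open>After multiplication by a Gaussian, theta at \<open>z / j\<close> for the transformed
  lattice has the quasi-periods of theta for \<open>\<tau>\<close>, so uniqueness applies. Only the
  independence of \<open>C\<close> from \<open>z\<close> matters later.\<close>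

lemma theta_moebius:
  assumes \<gamma>: "(a, b, c, d) \<in> SL2Z" and \<tau>: "\<tau> \<in> UHP"
  obtains C where "C \<noteq> 0"
    "\<And>z. theta (z / (of_int c * \<tau> + of_int d)) (moebius (a, b, c, d) \<tau>) =
           C * ee (of_int c * z\<^sup>2 / (2 * (of_int c * \<tau> + of_int d))) * theta z \<tau>"
proof -
  define j where "j = of_int c * \<tau> + of_int d"
  define t where "t = moebius (a, b, c, d) \<tau>"
  have j: "j \<noteq> 0" using moebius_denom_nonzero[OF \<gamma> \<tau>] by (simp add: j_def)
  have t: "t \<in> UHP" unfolding t_def by (rule moebius_in_UHP[OF \<gamma> \<tau>])
  have detZ: "a * d - b * c = 1" using \<gamma> by (simp add: SL2Z_def)
  hence "complex_of_int (a * d - b * c) = 1" by simp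
  hence det: "complex_of_int a * of_int d = 1 + of_int b * of_int c" by (simp add: algebra_simps)
  have tj: "t * j = of_int a * \<tau> + of_int b" using j by (simp add: t_def flip: j_def)
  \<comment> \<open>The inverse matrix expresses the periods 1/j and \<open>\<tau>\<close>/j in the
    basis t, 1.\<close>
  have inv_j: "1 / j = of_int (- c) * t + of_int a"
  proof -
    have "(of_int (- c) * t + of_int a) * j = of_int a * j - of_int c * (t * j)"
      by (simp add: algebra_simps)
    also have "\<dots> = 1" unfolding tj using det by (simp add: j_def algebra_simps)
    finally show ?thesis using j by (simp add: divide_eq_eq)
  qed
  have tau_j: "\<tau> / j = of_int d * t + of_int (- b)"
  proof -
    have "(of_int d * t + of_int (- b)) * j = of_int d * (t * j) - of_int b * j"
      by (simp add: algebra_simps)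
    also have "\<dots> = (of_int a * of_int d - of_int b * of_int c) * \<tau>"
      unfolding tj by (simp add: j_def algebra_simps)
    also have "\<dots> = \<tau>" by (simp add: det)
    finally show ?thesis using j by (simp add: divide_eq_eq)
  qed
  \<comment> \<open>The Gaussian is chosen so that its own change under a period cancels the
    unwanted linear terms in \<open>z\<close>.\<close>
  define G where "G z = ee (- of_int c * z\<^sup>2 / (2 * j)) * theta (z / j) t" for z
  have "\<exists>C. \<forall>z. G z = C * theta z \<tau>"
  proof (rule quasiperiodic_imp_multiple_of_theta[OF \<tau>])
    show "G holomorphic_on UNIV"
      unfolding G_def using j by (intro holomorphic_intros holomorphic_on_theta t) auto
    show "G 0 = 0" by (simp add: G_def t)
  next
    fix z
    \<comment> \<open>This integer is (1 + a)(1 - c) - 1. It is odd because determinant 1 prevents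
      \<open>a\<close> and \<open>c\<close> from both being even; the resulting sign is the required
      -1.\<close>
    have odd: "odd (a - c - a * c)"
    proof -
      have "odd (a * d - b * c)" using detZ by simp
      hence "odd a \<or> odd c" by auto
      thus ?thesis by auto
    qed
    have "(z + 1) / j = z / j + of_int (- c) * t + of_int a"
      by (simp only: add_divide_distrib inv_j add.assoc)
    hence "G (z + 1) = (ee (- of_int c * (z + 1)\<^sup>2 / (2 * j)) *
             ee (of_int (- c + a) / 2 - of_int (- c) * (z / j) - of_int (- c) ^ 2 * t / 2)) * theta (z / j) t"
      unfolding G_def by (simp only: theta_plus_lattice[OF t] mult.assoc)
    also have "ee (- of_int c * (z + 1)\<^sup>2 / (2 * j)) *
             ee (of_int (- c + a) / 2 - of_int (- c) * (z / j) - of_int (- c) ^ 2 * t / 2) =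
             ee (of_int (a - c - a * c) / 2) * ee (- of_int c * z\<^sup>2 / (2 * j))"
      unfolding ee_add[symmetric]
    proof (rule arg_cong[of _ _ ee])
      have 1: "- of_int c * (z + 1)\<^sup>2 / (2 * j) = - of_int c * z\<^sup>2 / (2 * j)
              - of_int c * (z / j) - of_int c * (1 / j) / 2"
        using j by (simp add: field_simps power2_eq_square)
      show "- of_int c * (z + 1)\<^sup>2 / (2 * j) +
             (of_int (- c + a) / 2 - of_int (- c) * (z / j) - of_int (- c) ^ 2 * t / 2) =
             of_int (a - c - a * c) / 2 + - of_int c * z\<^sup>2 / (2 * j)"
        unfolding 1 inv_j by (simp add: field_simps power2_eq_square)
    qed
    finally show "G (z + 1) = - G z"
      by (subst (asm) ee_odd_half[OF odd]) (simp add: G_def)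
  next
    fix z
    have odd: "odd (d - b - b * d)"
    proof -
      have "odd (a * d - b * c)" using detZ by simp
      hence "odd d \<or> odd b" by auto
      thus ?thesis by auto
    qed
    have "(z + \<tau>) / j = z / j + of_int d * t + of_int (- b)"
      by (simp only: add_divide_distrib tau_j add.assoc)
    hence "G (z + \<tau>) = (ee (- of_int c * (z + \<tau>)\<^sup>2 / (2 * j)) *
             ee (of_int (d + - b) / 2 - of_int d * (z / j) - of_int d ^ 2 * t / 2)) * theta (z / j) t"
      unfolding G_def by (simp only: theta_plus_lattice[OF t] mult.assoc)
    also have "ee (- of_int c * (z + \<tau>)\<^sup>2 / (2 * j)) *
             ee (of_int (d + - b) / 2 - of_int d * (z / j) - of_int d ^ 2 * t / 2) =
             ee (of_int (d - b - b * d) / 2) * ee (- z - \<tau> / 2) * ee (- of_int c * z\<^sup>2 / (2 * j))"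
      unfolding ee_add[symmetric]
    proof (rule arg_cong[of _ _ ee])
      have 1: "- of_int c * (z + \<tau>)\<^sup>2 / (2 * j) = - of_int c * z\<^sup>2 / (2 * j)
              - (of_int c * \<tau>) * (z / j) - of_int c * \<tau> * (\<tau> / j) / 2"
        using j by (simp add: field_simps power2_eq_square)
      have 2: "(of_int c * \<tau>) * (z / j) = z - of_int d * (z / j)"
      proof -
        have "(of_int c * \<tau> + of_int d) * (z / j) = z" using j by (simp flip: j_def)
        thus ?thesis by (simp add: algebra_simps)
      qed
      have 3: "of_int c * \<tau> * (\<tau> / j) = \<tau> + of_int b * of_int d - of_int d ^ 2 * t"
      proof -
        have "of_int d * (t * j) = (of_int a * of_int d) * \<tau> + of_int b * of_int d"
          unfolding tj by (simp add: algebra_simps)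
        thus ?thesis unfolding tau_j det by (simp add: j_def algebra_simps power2_eq_square)
      qed
      show "- of_int c * (z + \<tau>)\<^sup>2 / (2 * j) +
             (of_int (d + - b) / 2 - of_int d * (z / j) - of_int d ^ 2 * t / 2) =
             of_int (d - b - b * d) / 2 + (- z - \<tau> / 2) + - of_int c * z\<^sup>2 / (2 * j)"
        unfolding 1 2 3 by (simp add: field_simps)
    qed
    finally show "G (z + \<tau>) = - ee (- z - \<tau> / 2) * G z"
      by (subst (asm) ee_odd_half[OF odd]) (simp add: G_def)
  qed
  then obtain C where C: "\<And>z. G z = C * theta z \<tau>" by blast
  \<comment> \<open>At z = j/2 the theta factor of \<open>G\<close> is theta at 1/2.\<close>
  have "G (j / 2) \<noteq> 0" using theta_half_nonzero[OF t] j by (simp add: G_def)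
  hence "C \<noteq> 0" using C by auto
  moreover have "theta (z / j) t = C * ee (of_int c * z\<^sup>2 / (2 * j)) * theta z \<tau>" for z
    using C[of z] by (simp add: G_def ee_minus field_simps)
  ultimately show ?thesis using that by (simp add: j_def t_def)
qed

section \<open>Klein forms and their transformation laws\<close>

text \<open>Up to a factor depending on \<open>\<tau>\<close> alone, the Klein form of
  characteristic (r, s). The exponential absorbs the Gaussian of
  \<open>theta_moebius\<close>.\<close>

definition klein :: "complex \<Rightarrow> complex \<Rightarrow> complex \<Rightarrow> complex" where
  "klein r s \<tau> = ee (r * (r * \<tau> + s) / 2) * theta (r * \<tau> + s) \<tau>"

text \<open>The exponential prefactor cancels the \<open>\<tau>\<close>-dependence of the lattice
  multiplier. What remains is constant in \<open>\<tau>\<close>, and a root of unity for rational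
  \<open>r\<close> and \<open>s\<close>.\<close>

lemma klein_plus_int:
  assumes "\<tau> \<in> UHP"
  shows "klein (r + of_int m) (s + of_int n) \<tau> =
           ee ((of_int (m + n + m * n) + r * of_int n - of_int m * s) / 2) * klein r s \<tau>"
proof -
  define z where "z = r * \<tau> + s"
  have eq: "(r + of_int m) * \<tau> + (s + of_int n) = z + of_int m * \<tau> + of_int n"
    by (simp add: z_def algebra_simps)
  have "klein (r + of_int m) (s + of_int n) \<tau> =
          (ee ((r + of_int m) * (z + of_int m * \<tau> + of_int n) / 2) *
          ee (of_int (m + n) / 2 - of_int m * z - of_int m ^ 2 * \<tau> / 2)) * theta z \<tau>"
    unfolding klein_def eq by (simp only: theta_plus_lattice[OF assms] mult.assoc)
  also have "ee ((r + of_int m) * (z + of_int m * \<tau> + of_int n) / 2) *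
          ee (of_int (m + n) / 2 - of_int m * z - of_int m ^ 2 * \<tau> / 2) =
        ee ((of_int (m + n + m * n) + r * of_int n - of_int m * s) / 2) * ee (r * z / 2)"
    unfolding ee_add[symmetric]
    by (rule arg_cong[of _ _ ee]) (simp add: z_def field_simps power2_eq_square)
  finally show ?thesis by (simp add: klein_def z_def)
qed

text \<open>The matrix acts on the row vector (r, s) from the right. \<open>C\<close> is chosen
  before \<open>r\<close> and \<open>s\<close>, so it cancels in quotients.\<close>

lemma klein_moebius:
  assumes \<gamma>: "(a, b, c, d) \<in> SL2Z" and \<tau>: "\<tau> \<in> UHP"
  obtains C where "C \<noteq> 0" "\<And>r s. klein r s (moebius (a, b, c, d) \<tau>) =
    C * klein (r * of_int a + s * of_int c) (r * of_int b + s * of_int d) \<tau>"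
proof -
  define j where "j = of_int c * \<tau> + of_int d"
  define t where "t = moebius (a, b, c, d) \<tau>"
  have j: "j \<noteq> 0" using moebius_denom_nonzero[OF \<gamma> \<tau>] by (simp add: j_def)
  obtain C where C: "C \<noteq> 0" "\<And>z. theta (z / j) t = C * ee (of_int c * z\<^sup>2 / (2 * j)) * theta z \<tau>"
    using theta_moebius[OF \<gamma> \<tau>] unfolding j_def t_def by metis
  have "complex_of_int (a * d - b * c) = 1" using \<gamma> by (simp add: SL2Z_def)
  hence det: "complex_of_int a * of_int d = 1 + of_int b * of_int c" by (simp add: algebra_simps)
  have "klein r s t = C * klein (r * of_int a + s * of_int c) (r * of_int b + s * of_int d) \<tau>" for r s
  proof -
    define r' s' where "r' = r * of_int a + s * of_int c" and "s' = r * of_int b + s * of_int d"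
    define z where "z = r' * \<tau> + s'"
    have z: "r * t + s = z / j"
    proof -
      have tj: "t * j = of_int a * \<tau> + of_int b" using j by (simp add: t_def flip: j_def)
      have "(r * t + s) * j = r * (t * j) + s * j" by (simp add: algebra_simps)
      also have "\<dots> = z"
        unfolding tj by (simp add: z_def r'_def s'_def j_def algebra_simps)
      finally show ?thesis using j by (simp add: eq_divide_eq)
    qed
    have r: "r + of_int c * z = r' * j"
    proof -
      have "r' * of_int d - s' * of_int c = r * (of_int a * of_int d) - r * (of_int b * of_int c)"
        by (simp add: r'_def s'_def algebra_simps)
      also have "\<dots> = r" by (simp add: det algebra_simps)
      finally show ?thesis by (simp add: z_def j_def algebra_simps)
    qed
    have "r * (z / j) / 2 + of_int c * z\<^sup>2 / (2 * j) = (r + of_int c * z) * z / (2 * j)"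
      using j by (simp add: field_simps power2_eq_square)
    also have "\<dots> = r' * z / 2" unfolding r using j by simp
    finally have "ee (r * (z / j) / 2) * ee (of_int c * z\<^sup>2 / (2 * j)) = ee (r' * z / 2)"
      by (rule ee_mult_eqI)
    hence "klein r s t = C * (ee (r' * z / 2) * theta z \<tau>)"
      unfolding klein_def z C(2) by (simp add: mult_ac)
    thus ?thesis by (simp add: klein_def z_def r'_def s'_def)
  qed
  thus ?thesis using that C(1) by (simp add: t_def)
qed

lemma klein_quotient_moebius:
  assumes "(a, b, c, d) \<in> SL2Z" "\<tau> \<in> UHP"
  shows "klein r s (moebius (a, b, c, d) \<tau>) / klein r' s' (moebius (a, b, c, d) \<tau>) =
           klein (r * of_int a + s * of_int c) (r * of_int b + s * of_int d) \<tau> /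
           klein (r' * of_int a + s' * of_int c) (r' * of_int b + s' * of_int d) \<tau>"
  using klein_moebius[OF assms] by (metis mult_divide_mult_cancel_left)

section \<open>Behaviour at the cusps\<close>

lemma open_UHP: "open UHP"
  unfolding UHP_def by (rule open_halfspace_Im_gt)

lemma holomorphic_on_klein:
  assumes "open A" "f holomorphic_on A" "\<And>z. z \<in> A \<Longrightarrow> f z \<in> UHP"
  shows "(\<lambda>z. klein r s (f z)) holomorphic_on A"
  unfolding klein_def using assms by (intro holomorphic_intros holomorphic_on_theta) auto

text \<open>Conjugation by diag(M, 1) preserves the determinant; divisibility of \<open>c\<close> by
  \<open>M\<close> keeps the entries integral.\<close>

lemma moebius_scale:
  assumes "M > 0" "c = M * c'"
  shows "of_int M * moebius (a, b, c, d) \<tau> = moebius (a, M * b, c', d) (of_int M * \<tau>)"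
  using assms(1) by (simp add: assms(2) algebra_simps)

text \<open>This factors diag(M, 1) times (a, b; c, d) as a unimodular matrix times the upper
  triangular (A, B; 0, D). Divided by its gcd, the first column is primitive, and Bezout completes
  it to determinant 1.\<close>

lemma hermite_decomposition:
  fixes a b c d M :: int
  assumes det: "a * d - b * c = 1" and M: "M > 0"
  obtains a' b' c' d' A B D :: int where "a' * d' - b' * c' = 1" "A > 0" "D > 0"
    "a' * A = M * a" "a' * B + b' * D = M * b" "c' * A = c" "c' * B + d' * D = d"
proof -
  define g where "g = gcd (M * a) c"
  have "M * a \<noteq> 0 \<or> c \<noteq> 0" using det M by auto
  hence g: "g > 0" by (simp add: g_def)
  obtain a' where a': "M * a = g * a'" unfolding g_def by (meson dvdE gcd_dvd1)
  obtain c' where c': "c = g * c'" unfolding g_def by (meson dvdE gcd_dvd2)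
  obtain u v where uv: "u * (M * a) + v * c = g" unfolding g_def by (metis bezout_int)
  hence "g * (u * a' + v * c') = g * 1" unfolding a' c' by (simp add: algebra_simps)
  hence bez: "u * a' + v * c' = 1" using g by simp
  \<comment> \<open>The second column after multiplication by the inverse (u, v; -c', a') of the
    unimodular factor.\<close>
  define B D where "B = u * (M * b) + v * d" and "D = a' * d - c' * (M * b)"
  have "g * D = (g * a') * d - (g * c') * (M * b)" by (simp add: D_def algebra_simps)
  also have "\<dots> = M * (a * d - b * c)" 
    unfolding a'[symmetric] c'[symmetric] by (simp add: algebra_simps)
  finally have "g * D = M" by (simp add: det)
  hence "D > 0" using g M by (metis zero_less_mult_pos)
  moreover have "a' * B + (- v) * D = (u * a' + v * c') * (M * b)"
    by (simp add: B_def D_def algebra_simps)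
  hence "a' * B + (- v) * D = M * b" by (simp add: bez)
  moreover have "c' * B + u * D = (u * a' + v * c') * d"
    by (simp add: B_def D_def algebra_simps)
  hence "c' * B + u * D = d" by (simp add: bez)
  ultimately show ?thesis
    using bez g a' c' by (intro that[of a' u "- v" c' g D B]) (simp_all add: algebra_simps)
qed

lemma UHP_affine:
  assumes "\<tau> \<in> UHP" "A > 0" "D > 0"
  shows "(of_int A * \<tau> + of_int B) / of_int D \<in> UHP"
  using assms by (simp add: UHP_def)

text \<open>For 0 <= k < N both products involve only nonnegative powers of the local parameter u,
  so they are holomorphic in the unit disc; a pole can come only from the monomial
  \<open>u powi n3\<close>.\<close>

lemma klein_meromorphic_at_infinity_reduced:
  fixes k A B D N :: int
  assumes "A > 0" "D > 0" "N > 0" "0 \<le> k" "k < N"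
  shows "\<exists>F. F meromorphic_on {0} \<and> (\<forall>\<tau>\<in>UHP.
           klein (of_int k / of_int N) s ((of_int A * \<tau> + of_int B) / of_int D) =
           F (ee (\<tau> / of_int (2 * N ^ 2 * D))))"
proof -
  define r where "r = (of_int k / of_int N :: complex)"
  define \<beta> where "\<beta> = (of_int B / of_int D :: complex)"
  \<comment> \<open>The parameter u is \<open>ee\<close> of \<open>\<tau>\<close> / (2 N^2 D). The
    factor 2 N^2 clears the denominators of r (r - 1) / 2, which makes all exponents
    integers.\<close>
  define n0 where "n0 = nat (2 * N ^ 2 * A)"
  define n1 where "n1 = nat (2 * N * k * A)"
  define n2 where "n2 = nat (2 * N * (N - k) * A)"
  define n3 where "n3 = (k - N) * k * A"
  define P where "P u = qpoch_inf (ee (r * \<beta> + s) * u ^ n1) (ee \<beta> * u ^ n0) *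
                        qpoch_inf (ee ((1 - r) * \<beta> - s) * u ^ n2) (ee \<beta> * u ^ n0)" for u
  define F where "F u = ee ((r - 1) * (r * \<beta> + s) / 2) * u powi n3 * P u" for u
  have n0: "n0 > 0" using assms by (simp add: n0_def)
  \<comment> \<open>\<open>\<beta>\<close> is real.\<close>
  have "norm (ee \<beta>) = 1" by (simp add: norm_ee \<beta>_def)
  hence less1: "norm (ee \<beta> * u ^ n0) < 1" if "u \<in> ball 0 1" for u
    using that n0 by (simp add: norm_mult norm_power power_less_one_iff)
  have "P holomorphic_on ball 0 1"
    unfolding P_def by (intro holomorphic_intros holomorphic_on_qpoch_inf less1) auto
  hence "P analytic_on {0}"
    by (meson analytic_at centre_in_ball open_ball zero_less_one)
  hence "F meromorphic_on {0}"
    unfolding F_def by (intro meromorphic_intros analytic_on_imp_meromorphic_on)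
  moreover have "klein r s ((of_int A * \<tau> + of_int B) / of_int D) = F (ee (\<tau> / of_int (2 * N ^ 2 * D)))"
    if "\<tau> \<in> UHP" for \<tau>
  proof -
    define t where "t = (of_int A * \<tau> + of_int B) / of_int D"
    define u where "u = ee (\<tau> / of_int (2 * N ^ 2 * D))"
    have [simp]: "N \<noteq> 0" "D \<noteq> 0" using assms by auto
    have nonneg: "0 \<le> 2 * N ^ 2 * A" "0 \<le> 2 * N * k * A" "0 \<le> 2 * N * (N - k) * A"
      using assms by auto
    have *: "of_nat (nat x) = (of_int x :: complex)" if "0 \<le> x" for x
      using that by simp
    have 0: "ee \<beta> * u ^ n0 = ee t"
      unfolding u_def ee_power n0_def *[OF nonneg(1)]
      by (rule ee_mult_eqI) (simp add: \<beta>_def t_def field_simps)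
    have 1: "ee (r * \<beta> + s) * u ^ n1 = ee (r * t + s)"
      unfolding u_def ee_power n1_def *[OF nonneg(2)]
      by (rule ee_mult_eqI) (simp add: \<beta>_def t_def r_def field_simps power2_eq_square)
    have 2: "ee ((1 - r) * \<beta> - s) * u ^ n2 = ee (t - (r * t + s))"
      unfolding u_def ee_power n2_def *[OF nonneg(3)]
      by (rule ee_mult_eqI) (simp add: \<beta>_def t_def r_def field_simps power2_eq_square)
    have 3: "ee ((r - 1) * (r * \<beta> + s) / 2) * u powi n3 = ee (r * (r * t + s) / 2) * ee (- (r * t + s) / 2)"
      unfolding u_def ee_powi n3_def ee_add[symmetric]
      by (rule arg_cong[of _ _ ee]) (simp add: \<beta>_def t_def r_def field_simps power2_eq_square)
    show ?thesis
      unfolding F_def P_def u_def[symmetric] t_def[symmetric] 0 1 2 3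
      by (simp add: klein_def theta_def)
  qed
  ultimately show ?thesis unfolding r_def by blast
qed

text \<open>An integer shift reduces \<open>k\<close> modulo \<open>N\<close> at the cost of a
  constant factor.\<close>

lemma klein_meromorphic_at_infinity:
  fixes k A B D N :: int
  assumes "A > 0" "D > 0" "N > 0"
  shows "\<exists>F. F meromorphic_on {0} \<and> (\<forall>\<tau>\<in>UHP.
           klein (of_int k / of_int N) s ((of_int A * \<tau> + of_int B) / of_int D) =
           F (ee (\<tau> / of_int (2 * N ^ 2 * D))))"
proof -
  define m k' where "m = k div N" and "k' = k mod N"
  have "k = k' + m * N" by (simp add: m_def k'_def)
  hence k: "of_int k / of_int N = (of_int k' / of_int N + of_int m :: complex)"
    using assms by (simp add: field_simps)
  obtain F where F: "F meromorphic_on {0}" "\<And>\<tau>. \<tau> \<in> UHP \<Longrightarrow>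
           klein (of_int k' / of_int N) s ((of_int A * \<tau> + of_int B) / of_int D) =
           F (ee (\<tau> / of_int (2 * N ^ 2 * D)))"
    using klein_meromorphic_at_infinity_reduced[of A D N k' s B] assms by (auto simp: k'_def)
  define C where "C = ee ((of_int m - of_int m * s) / 2)"
  have "klein (of_int k / of_int N) s ((of_int A * \<tau> + of_int B) / of_int D) =
          C * F (ee (\<tau> / of_int (2 * N ^ 2 * D)))" if "\<tau> \<in> UHP" for \<tau>
    using klein_plus_int[OF UHP_affine[OF that assms(1,2)], of "of_int k' / of_int N" m s 0 B] F(2)[OF that]
    by (simp add: k C_def)
  moreover have "(\<lambda>u. C * F u) meromorphic_on {0}"
    by (intro meromorphic_intros F)
  ultimately show ?thesis by blast
qed

section \<open>Quotients and modular functions\<close>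

definition klein_quot :: "int \<Rightarrow> int \<Rightarrow> int \<Rightarrow> complex \<Rightarrow> complex" where
  "klein_quot N k l \<tau> = klein (of_int k / of_int N) 0 \<tau> / klein (of_int l / of_int N) 0 \<tau>"

lemma klein_quot_meromorphic_on_UHP:
  assumes "M > 0"
  shows "(\<lambda>\<tau>. klein_quot N k l (of_int M * \<tau>)) meromorphic_on UHP"
proof -
  have "(\<lambda>\<tau>. klein (of_int k / of_int N) 0 (of_int M * \<tau>)) analytic_on UHP" for k
    unfolding analytic_on_open[OF open_UHP]
    by (intro holomorphic_on_klein open_UHP holomorphic_intros) (use assms in \<open>auto simp: UHP_def\<close>)
  thus ?thesis
    unfolding klein_quot_def by (intro meromorphic_intros analytic_on_imp_meromorphic_on)
qed

lemma klein_quot_meromorphic_at_cusps: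
  assumes "\<gamma> \<in> SL2Z" "M > 0" "N > 0"
  shows "meromorphic_at_infinity (\<lambda>\<tau>. klein_quot N k l (of_int M * moebius \<gamma> \<tau>))"
proof -
  obtain a b c d where \<gamma>: "\<gamma> = (a, b, c, d)" by (cases \<gamma>) auto
  have "a * d - b * c = 1" using assms(1) by (simp add: \<gamma> SL2Z_def)
  then obtain a' b' c' d' A B D :: int where H: "a' * d' - b' * c' = 1" "A > 0" "D > 0"
    "a' * A = M * a" "a' * B + b' * D = M * b" "c' * A = c" "c' * B + d' * D = d"
    using hermite_decomposition[OF _ assms(2)] by metis
  have \<gamma>': "(a', b', c', d') \<in> SL2Z" using H(1) by (simp add: SL2Z_def)
  define t where "t \<tau> = (of_int A * \<tau> + of_int B) / of_int D" for \<tau> :: complex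
  have t: "t \<tau> \<in> UHP" if "\<tau> \<in> UHP" for \<tau>
    unfolding t_def using UHP_affine[OF that H(2,3)] .
  have M_moebius: "of_int M * moebius \<gamma> \<tau> = moebius (a', b', c', d') (t \<tau>)" for \<tau>
  proof -
    have D: "complex_of_int D \<noteq> 0" using H(3) by simp
    have "of_int a' * t \<tau> + of_int b' = (of_int (a' * A) * \<tau> + of_int (a' * B + b' * D)) / of_int D"
      using D by (simp add: t_def field_simps)
    hence 1: "of_int a' * t \<tau> + of_int b' = of_int M * (of_int a * \<tau> + of_int b) / of_int D"
      unfolding H by (simp add: algebra_simps)
    have "of_int c' * t \<tau> + of_int d' = (of_int (c' * A) * \<tau> + of_int (c' * B + d' * D)) / of_int D"
      using D by (simp add: t_def field_simps)
    hence 2: "of_int c' * t \<tau> + of_int d' = (of_int c * \<tau> + of_int d) / of_int D"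
      unfolding H .
    show ?thesis unfolding \<gamma> moebius.simps 1 2 using D by simp
  qed
  have "\<exists>F. F meromorphic_on {0} \<and> (\<forall>\<tau>\<in>UHP.
           klein (of_int (k * a') / of_int N) s (t \<tau>) = F (ee (\<tau> / of_int (2 * N ^ 2 * D))))" for k s
    unfolding t_def by (rule klein_meromorphic_at_infinity[OF H(2,3) assms(3)])
  \<comment> \<open>The local parameter depends on \<open>N\<close> and \<open>D\<close> only, so
    numerator and denominator are functions of the same variable.\<close>
  then obtain F where F: "\<And>k s. F k s meromorphic_on {0}" "\<And>k s \<tau>. \<tau> \<in> UHP \<Longrightarrow>
      klein (of_int (k * a') / of_int N) s (t \<tau>) = F k s (ee (\<tau> / of_int (2 * N ^ 2 * D)))"
    by metis
  let ?s = "\<lambda>k. of_int k / of_int N * of_int b'"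
  have "klein_quot N k l (of_int M * moebius \<gamma> \<tau>) =
          F k (?s k) (qpow (1 / real (nat (2 * N ^ 2 * D))) \<tau>) /
          F l (?s l) (qpow (1 / real (nat (2 * N ^ 2 * D))) \<tau>)"
    if \<tau>: "\<tau> \<in> UHP" for \<tau>
  proof -
    have "real (nat (2 * N ^ 2 * D)) = of_int (2 * N ^ 2 * D)"
      using H(3) by simp
    hence "qpow (1 / real (nat (2 * N ^ 2 * D))) \<tau> = ee (\<tau> / of_int (2 * N ^ 2 * D))"
      by (simp add: qpow_conv_ee)
    moreover have "klein_quot N k l (of_int M * moebius \<gamma> \<tau>) =
        klein (of_int (k * a') / of_int N) (?s k) (t \<tau>) / klein (of_int (l * a') / of_int N) (?s l) (t \<tau>)"
      unfolding klein_quot_def M_moebius klein_quotient_moebius[OF \<gamma>' t[OF \<tau>]] by simp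
    ultimately show ?thesis using F(2)[OF \<tau>] by simp
  qed
  moreover have "(\<lambda>u. F k (?s k) u / F l (?s l) u) meromorphic_on {0}"
    by (intro meromorphic_intros F(1))
  moreover have "nat (2 * N ^ 2 * D) > 0" using H(3) assms(3) by simp
  ultimately show ?thesis
    unfolding meromorphic_at_infinity_def
    by (intro exI[of _ "nat (2 * N ^ 2 * D)"] conjI exI[of _ "\<lambda>u. F k (?s k) u / F l (?s l) u"]) auto
qed

lemma meromorphic_at_infinity_power:
  assumes "meromorphic_at_infinity f"
  shows "meromorphic_at_infinity (\<lambda>\<tau>. f \<tau> ^ n)"
proof -
  from assms obtain N F where "N > 0" "\<forall>\<tau>\<in>UHP. f \<tau> = F (qpow (1 / real N) \<tau>)" "F meromorphic_on {0}"
    unfolding meromorphic_at_infinity_def by blast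
  moreover from this have "(\<lambda>u. F u ^ n) meromorphic_on {0}" by (intro meromorphic_intros)
  ultimately show ?thesis
    unfolding meromorphic_at_infinity_def
    by (intro exI[of _ N] conjI exI[of _ "\<lambda>u. F u ^ n"]) auto
qed

text \<open>Conjugation by diag(N e, 1) makes the upper right entry N e b, so (k/N, 0) goes to (k/N
  + k n, k e b), an integral shift. The cases e = 1 and e = 4 serve the levels 10 and 40.\<close>

lemma klein_quot_Gamma1:
  fixes N e n a b c d k l :: int
  assumes \<gamma>: "(a, b, c, d) \<in> SL2Z" and pos: "N > 0" "e > 0"
    and a: "a = 1 + N * n" and c: "N * e dvd c" and \<tau>: "\<tau> \<in> UHP"
  shows "klein_quot N k l (of_int (N * e) * moebius (a, b, c, d) \<tau>) =
           ee ((of_int ((k - l) * (n + e * b) + (k\<^sup>2 - l\<^sup>2) * n * e * b) +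
                of_int ((k\<^sup>2 - l\<^sup>2) * e * b) / of_int N) / 2) *
           klein_quot N k l (of_int (N * e) * \<tau>)"
proof -
  obtain c' where c': "c = N * e * c'" using c by (elim dvdE)
  have M: "N * e > 0" using pos by simp
  define t where "t = of_int (N * e) * \<tau>"
  have t: "t \<in> UHP" using \<tau> pos by (simp add: t_def UHP_def)
  have [simp]: "N \<noteq> 0" using pos by simp
  have \<gamma>': "(a, N * e * b, c', d) \<in> SL2Z"
    using \<gamma> by (simp add: SL2Z_def c' algebra_simps)
  \<comment> \<open>The exponent in \<open>klein_plus_int\<close> for the shift by (k n, k e
    b).\<close>
  define E where "E k = (of_int (k * n + k * e * b + k * n * (k * e * b)) +
    of_int k / of_int N * of_int (k * e * b) :: complex) / 2" for k :: int
  have klein: "klein (of_int k / of_int N * of_int a + 0 * of_int c')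
      (of_int k / of_int N * of_int (N * e * b) + 0 * of_int d) t = ee (E k) * klein (of_int k / of_int N) 0 t"
    for k
  proof -
    have "of_int k / of_int N * of_int a + 0 * of_int c' = (of_int k / of_int N + of_int (k * n) :: complex)"
      by (simp add: a field_simps)
    moreover have "of_int k / of_int N * of_int (N * e * b) + 0 * of_int d = (0 + of_int (k * e * b) :: complex)"
      by simp
    ultimately show ?thesis
      by (simp only: klein_plus_int[OF t] E_def mult_zero_right diff_zero)
  qed
  have "klein_quot N k l (of_int (N * e) * moebius (a, b, c, d) \<tau>) =
          klein_quot N k l (moebius (a, N * e * b, c', d) t)"
    unfolding moebius_scale[OF M c'] t_def ..
  also have "\<dots> = ee (E k) / ee (E l) * klein_quot N k l t"
    unfolding klein_quot_def klein_quotient_moebius[OF \<gamma>' t] klein by simp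
  also have "ee (E k) / ee (E l) = ee (E k - E l)" by (simp add: ee_diff)
  also have "E k - E l = (of_int ((k - l) * (n + e * b) + (k\<^sup>2 - l\<^sup>2) * n * e * b) +
                of_int ((k\<^sup>2 - l\<^sup>2) * e * b) / of_int N) / 2"
    unfolding E_def by (simp add: field_simps power2_eq_square)
  finally show ?thesis unfolding t_def .
qed

section \<open>I and J as Klein quotients, and their modularity\<close>

lemma klein_eq_qpoch:
  fixes k N :: nat
  assumes "k \<le> N" "N > 0"
  shows "klein (of_int (int k) / of_int (int N)) 0 (of_int (int N) * \<tau>) =
           ee ((of_nat k ^ 2 / of_nat N - of_nat k) / 2 * \<tau>) *
           (qpoch_inf (qpow 1 \<tau> ^ k) (qpow 1 \<tau> ^ N) * qpoch_inf (qpow 1 \<tau> ^ (N - k)) (qpow 1 \<tau> ^ N))"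
proof -
  have [simp]: "N \<noteq> 0" using assms by simp
  have z: "of_int (int k) / of_int (int N) * (of_int (int N) * \<tau>) + 0 = of_nat k * \<tau>"
    by simp
  have E: "ee (of_int (int k) / of_int (int N) * (of_nat k * \<tau>) / 2) * ee (- (of_nat k * \<tau>) / 2) =
          ee ((of_nat k ^ 2 / of_nat N - of_nat k) / 2 * \<tau>)"
    by (rule ee_mult_eqI) (simp add: field_simps power2_eq_square)
  have q: "of_int (int N) * \<tau> - of_nat k * \<tau> = of_nat (N - k) * \<tau>"
    using assms by (simp add: of_nat_diff algebra_simps)
  have "klein (of_int (int k) / of_int (int N)) 0 (of_int (int N) * \<tau>) =
          (ee (of_int (int k) / of_int (int N) * (of_nat k * \<tau>) / 2) * ee (- (of_nat k * \<tau>) / 2)) *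
          (qpoch_inf (ee (of_nat k * \<tau>)) (ee (of_int (int N) * \<tau>)) *
           qpoch_inf (ee (of_nat (N - k) * \<tau>)) (ee (of_int (int N) * \<tau>)))"
    unfolding klein_def theta_def z q by (simp only: mult.assoc)
  thus ?thesis
    unfolding E by (simp add: qpow_conv_ee ee_power)
qed

text \<open>The prefactors for k = 1 and k = 4 have q-exponents -9/20 and -24/20, whose difference
  is 3/4.\<close>

lemma Ifun_eq_klein_quot: "Ifun \<tau> = klein_quot 10 1 4 (10 * \<tau>)"
proof -
  have "ee (of_real (3/4) * \<tau>) = ee (((1::complex)\<^sup>2 / 10 - 1) / 2 * \<tau> - (4\<^sup>2 / 10 - 4) / 2 * \<tau>)"
    by (rule arg_cong[of _ _ ee]) (simp add: field_simps)
  also have "\<dots> = ee (((1::complex)\<^sup>2 / 10 - 1) / 2 * \<tau>) / ee ((4\<^sup>2 / 10 - 4) / 2 * \<tau>)"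
    by (rule ee_diff)
  finally have "qpow (3/4) \<tau> = ee (((1::complex)\<^sup>2 / 10 - 1) / 2 * \<tau>) / ee ((4\<^sup>2 / 10 - 4) / 2 * \<tau>)"
    by (simp only: qpow_conv_ee)
  thus ?thesis
    using klein_eq_qpoch[of 1 10 \<tau>] klein_eq_qpoch[of 4 10 \<tau>]
    by (simp add: Ifun_def klein_quot_def Let_def)
qed

text \<open>Here the q-exponents are -16/20 and -21/20, with difference 1/4.\<close>

lemma Jfun_eq_klein_quot: "Jfun \<tau> = klein_quot 10 2 3 (10 * \<tau>)"
proof -
  have "ee (of_real (1/4) * \<tau>) = ee (((2::complex)\<^sup>2 / 10 - 2) / 2 * \<tau> - (3\<^sup>2 / 10 - 3) / 2 * \<tau>)"
    by (rule arg_cong[of _ _ ee]) (simp add: field_simps)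
  also have "\<dots> = ee (((2::complex)\<^sup>2 / 10 - 2) / 2 * \<tau>) / ee ((3\<^sup>2 / 10 - 3) / 2 * \<tau>)"
    by (rule ee_diff)
  finally have "qpow (1/4) \<tau> = ee (((2::complex)\<^sup>2 / 10 - 2) / 2 * \<tau>) / ee ((3\<^sup>2 / 10 - 3) / 2 * \<tau>)"
    by (simp only: qpow_conv_ee)
  thus ?thesis
    using klein_eq_qpoch[of 2 10 \<tau>] klein_eq_qpoch[of 3 10 \<tau>]
    by (simp add: Jfun_def klein_quot_def Let_def)
qed

text \<open>The divisibility condition makes the multiplier in \<open>klein_quot_Gamma1\<close> a fourth root of unity.
  Passing to level 40 and argument \<open>40 \<tau>\<close> multiplies every term of its exponent by 4 or 16.\<close>
lemma modular_function_klein_quot_power4: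
  assumes "5 dvd k\<^sup>2 - l\<^sup>2"
  shows "modular_function (Gamma1 10) (\<lambda>\<tau>. klein_quot 10 k l (10 * \<tau>) ^ 4)"
  unfolding modular_function_def
proof (intro conjI ballI)
  show "(\<lambda>\<tau>. klein_quot 10 k l (10 * \<tau>) ^ 4) meromorphic_on UHP"
    using klein_quot_meromorphic_on_UHP[of 10 10 k l] by (intro meromorphic_intros) simp
  show "meromorphic_at_infinity (\<lambda>\<tau>. klein_quot 10 k l (10 * moebius \<gamma> \<tau>) ^ 4)"
    if "\<gamma> \<in> SL2Z" for \<gamma>
    using klein_quot_meromorphic_at_cusps[OF that, of 10 10 k l]
    by (intro meromorphic_at_infinity_power) simp
next
  fix \<gamma> \<tau> assume \<gamma>: "\<gamma> \<in> Gamma1 10" and \<tau>: "\<tau> \<in> UHP"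
  obtain a b c d where abcd: "\<gamma> = (a, b, c, d)" by (cases \<gamma>) auto
  have SL: "(a, b, c, d) \<in> SL2Z" and "[a = 1] (mod 10)" and c: "10 dvd c"
    using \<gamma> by (auto simp: abcd Gamma1_def cong_0_iff)
  then obtain n where a: "a = 1 + 10 * n" by (metis cong_iff_lin cong_sym)
  obtain f where f: "k\<^sup>2 - l\<^sup>2 = 5 * f" using assms by (elim dvdE)
  define x where "x = (of_int ((k - l) * (n + 1 * b) + (k\<^sup>2 - l\<^sup>2) * n * 1 * b) +
      of_int ((k\<^sup>2 - l\<^sup>2) * 1 * b) / of_int 10 :: complex) / 2"
  \<comment> \<open>\<open>x\<close> is half an integer plus f b / 4, since the 5 cancels against
    the denominator 10.\<close>
  have "4 * x = of_int (2 * ((k - l) * (n + b) + (k\<^sup>2 - l\<^sup>2) * n * b) + f * b)"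
    unfolding x_def f by (simp add: field_simps)
  hence "ee x ^ 4 = 1" using ee_power[of x 4] by (metis ee_of_int of_nat_numeral)
  moreover have "klein_quot 10 k l (10 * moebius \<gamma> \<tau>) = ee x * klein_quot 10 k l (10 * \<tau>)"
    using klein_quot_Gamma1[OF SL _ _ a _ \<tau>, of 1 k l] c unfolding x_def abcd by simp
  ultimately show "klein_quot 10 k l (10 * moebius \<gamma> \<tau>) ^ 4 = klein_quot 10 k l (10 * \<tau>) ^ 4"
    by (simp only: power_mult_distrib mult_1_left)
qed

lemma modular_function_klein_quot_times4:
  assumes "5 dvd k\<^sup>2 - l\<^sup>2"
  shows "modular_function (Gamma1 40) (\<lambda>\<tau>. klein_quot 10 k l (40 * \<tau>))"
  unfolding modular_function_def
proof (intro conjI ballI)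
  show "(\<lambda>\<tau>. klein_quot 10 k l (40 * \<tau>)) meromorphic_on UHP"
    using klein_quot_meromorphic_on_UHP[of 40 10 k l] by simp
  show "meromorphic_at_infinity (\<lambda>\<tau>. klein_quot 10 k l (40 * moebius \<gamma> \<tau>))"
    if "\<gamma> \<in> SL2Z" for \<gamma>
    using klein_quot_meromorphic_at_cusps[OF that, of 40 10 k l] by simp
next
  fix \<gamma> \<tau> assume \<gamma>: "\<gamma> \<in> Gamma1 40" and \<tau>: "\<tau> \<in> UHP"
  obtain a b c d where abcd: "\<gamma> = (a, b, c, d)" by (cases \<gamma>) auto
  have SL: "(a, b, c, d) \<in> SL2Z" and "[a = 1] (mod 40)" and c: "40 dvd c"
    using \<gamma> by (auto simp: abcd Gamma1_def cong_0_iff)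
  then obtain n where "a = 1 + 40 * n" by (metis cong_iff_lin cong_sym)
  \<comment> \<open>The level of the Klein forms stays 10, so \<open>klein_quot_Gamma1\<close> is
    used with 4 n in place of n and with e = 4.\<close>
  hence a: "a = 1 + 10 * (4 * n)" by simp
  obtain f where f: "k\<^sup>2 - l\<^sup>2 = 5 * f" using assms by (elim dvdE)
  define x where "x = (of_int ((k - l) * (4 * n + 4 * b) + (k\<^sup>2 - l\<^sup>2) * (4 * n) * 4 * b) +
      of_int ((k\<^sup>2 - l\<^sup>2) * 4 * b) / of_int 10 :: complex) / 2"
  have "x = of_int (2 * (k - l) * (n + b) + 8 * (k\<^sup>2 - l\<^sup>2) * n * b + f * b)"
    unfolding x_def f by (simp add: field_simps)
  hence "ee x = 1" by (metis ee_of_int)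
  moreover have "klein_quot 10 k l (40 * moebius \<gamma> \<tau>) = ee x * klein_quot 10 k l (40 * \<tau>)"
    using klein_quot_Gamma1[OF SL _ _ a _ \<tau>, of 4 k l] c unfolding x_def abcd by simp
  ultimately show "klein_quot 10 k l (40 * moebius \<gamma> \<tau>) = klein_quot 10 k l (40 * \<tau>)"
    by (simp only: mult_1_left)
qed

theorem theorem3p3:
  shows "modular_function (Gamma1 10) (\<lambda>\<tau>. (Ifun \<tau>) ^ 4)
       \<and> modular_function (Gamma1 10) (\<lambda>\<tau>. (Jfun \<tau>) ^ 4)
       \<and> modular_function (Gamma1 40) (\<lambda>\<tau>. Ifun (4 * \<tau>))
       \<and> modular_function (Gamma1 40) (\<lambda>\<tau>. Jfun (4 * \<tau>))"
  \<comment> \<open>The divisibility conditions hold because 1 - 16 = -15 and 4 - 9 = -5.\<close>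
  using modular_function_klein_quot_power4[of 1 4] modular_function_klein_quot_power4[of 2 3]
    modular_function_klein_quot_times4[of 1 4] modular_function_klein_quot_times4[of 2 3]
  by (simp add: Ifun_eq_klein_quot Jfun_eq_klein_quot)

end
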